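(* Let $(F,\eta)$ be a pointed endofunctor of $\mathcal{C}$ and let $\mathcal{S}$ be a simple co-perfect syntopogenous structure on $\mathcal{C}$, i.e. $\mathcal{S}_X=\{\sqsubset_X\}$ for every $X\in\mathcal{C}$, where $\sqsubset$ is a $\bigwedge$-preserving interpolative topogenous order on $\mathcal{C}$. Then $$c^{\sqsubset^{F,\eta}}_X(m)=\eta_X^{-1}\big(c^{\sqsubset}_{FX}(\eta_X(m))\big)\qquad(m\in\mathrm{sub}X,\ X\in\mathcal{C})$$ defines an idempotent closure operator $c^{\sqsubset^{F,\eta}}$ on $\mathcal{C}$. It is the largest closure operator on $\mathcal{C}$ for which every $\eta_X:X\to FX$ is $(c^{\sqsubset^{F,\eta}},c^{\sqsubset})$-continuous.
   Context: $\mathcal{C}$ is a category with a proper $(\mathcal{E},\mathcal{M})$-factorization system for morphisms ($\mathcal{E}$ consists of epimorphisms, $\mathcal{M}$ of monomorphisms), and it is $\mathcal{M}$-complete: pullbacks of $\mathcal{M}$-morphisms along arbitrary morphisms and arbitrary $\mathcal{M}$-intersections exist and are again in $\mathcal{M}$. The class $\mathcal{E}$ is stable under pullbacks along $\mathcal{M}$-morphisms. For $X\in\mathcal{C}$, $\mathrm{sub}X=\{m\in\mathcal{M}\mid \mathrm{cod}(m)=X\}$, ordered by $n\le m$ iff $m\circ j=n$ for some $j$; isomorphic subobjects are identified, so $\mathrm{sub}X$ is a (possibly large) complete lattice. For $f:X\to Y$, $f(m)$ is the $\mathcal{M}$-component of the factorization of $f\circ m$ and $f^{-1}(n)$ is the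 pullback of $n$ along $f$. A pointed endofunctor $(F,\eta)$ is a functor $F:\mathcal{C}\to\mathcal{C}$ with a natural transformation $\eta:1_{\mathcal{C}}\to F$. A topogenous order on $\mathcal{C}$ is a family of relations $\sqsubset_X$ on $\mathrm{sub}X$ ($X\in\mathcal{C}$) with (T1) $m\sqsubset_X n\Rightarrow m\le n$; (T2) $m\le n\sqsubset_X p\le q\Rightarrow m\sqsubset_X q$; (T3) for every $f:X\to Y$, $m\sqsubset_Y n\Rightarrow f^{-1}(m)\sqsubset_X f^{-1}(n)$. It is $\bigwedge$-preserving if ($m\sqsubset_X n_i$ for all $i\in I$) implies $m\sqsubset_X\bigwedge n_i$, and interpolative if $m\sqsubset_X n$ implies $m\sqsubset_X p\sqsubset_X n$ for some $p$. For such $\sqsubset$, $c^{\sqsubset}_X(m)=\bigwedge\{p\mid m\sqsubset_X p\}$. A closure operator $c$ on $\mathcal{C}$ with respect to $\mathcal{M}$ is a family of maps $c_X:\mathrm{sub}X\to\mathrm{sub}X$ with (C1) $m\le c_X(m)$; (C2) $m\le n\Rightarrow c_X(m)\le c_X(n)$; (C3) $f(c_X(m))\le c_Y(f(m))$ for every $f:X\to Y$ and $m\in\mathrm{sub}X$. It is idempotent if $c_X(c_X(m))=c_X(m)$. Order: $c\le c'$ iff $c_X(m)\le c'_X(m)$ for all $X$ and $m$. For closure operators $c,c'$, a morphism $f:X\to Y$ is $(c,c')$-continuous if $f(c_X(m))\le c'_Y(f(m))$ for all $m\in\mathrm{sub}X$. *)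

theory Defs
  imports "HOL-Algebra.Complete_Lattice"
begin

record ('o, 'a) category =
  Obj :: "'o set"
  Arr :: "'a set"
  Dom :: "'a \<Rightarrow> 'o"
  Cod :: "'a \<Rightarrow> 'o"
  Id :: "'o \<Rightarrow> 'a"
  Comp :: "'a \<Rightarrow> 'a \<Rightarrow> 'a"  (infixr \<open>\<cdot>\<index>\<close> 70)

record ('o, 'a) em_category = "('o, 'a) category" +
  EE :: "'a set"
  MM :: "'a set"

definition Hom :: "('o, 'a, 'z) category_scheme \<Rightarrow> 'o \<Rightarrow> 'o \<Rightarrow> 'a set" where
  "Hom C X Y = {f \<in> Arr C. Dom C f = X \<and> Cod C f = Y}"

locale category =
  fixes C :: "('o, 'a, 'z) category_scheme" (structure)
  assumes Dom_in_Obj: "f \<in> Arr C \<Longrightarrow> Dom C f \<in> Obj C"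
    and Cod_in_Obj: "f \<in> Arr C \<Longrightarrow> Cod C f \<in> Obj C"
    and Id_in_Hom: "X \<in> Obj C \<Longrightarrow> Id C X \<in> Hom C X X"
    and Comp_in_Hom: "f \<in> Hom C X Y \<Longrightarrow> g \<in> Hom C Y Z \<Longrightarrow> g \<cdot> f \<in> Hom C X Z"
    and Id_left: "f \<in> Hom C X Y \<Longrightarrow> Id C Y \<cdot> f = f"
    and Id_right: "f \<in> Hom C X Y \<Longrightarrow> f \<cdot> Id C X = f"
    and Comp_assoc:
      "f \<in> Hom C W X \<Longrightarrow> g \<in> Hom C X Y \<Longrightarrow> h \<in> Hom C Y Z \<Longrightarrow> (h \<cdot> g) \<cdot> f = h \<cdot> (g \<cdot> f)"

definition is_mono :: "('o, 'a, 'z) category_scheme \<Rightarrow> 'a \<Rightarrow> bool" where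
  "is_mono C m \<longleftrightarrow> m \<in> Arr C \<and>
     (\<forall>W. \<forall>g \<in> Hom C W (Dom C m). \<forall>h \<in> Hom C W (Dom C m).
        m \<cdot>\<^bsub>C\<^esub> g = m \<cdot>\<^bsub>C\<^esub> h \<longrightarrow> g = h)"

definition is_epi :: "('o, 'a, 'z) category_scheme \<Rightarrow> 'a \<Rightarrow> bool" where
  "is_epi C e \<longleftrightarrow> e \<in> Arr C \<and>
     (\<forall>Z. \<forall>g \<in> Hom C (Cod C e) Z. \<forall>h \<in> Hom C (Cod C e) Z.
        g \<cdot>\<^bsub>C\<^esub> e = h \<cdot>\<^bsub>C\<^esub> e \<longrightarrow> g = h)"

definition is_iso :: "('o, 'a, 'z) category_scheme \<Rightarrow> 'a \<Rightarrow> bool" where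
  "is_iso C f \<longleftrightarrow> f \<in> Arr C \<and>
     (\<exists>g \<in> Hom C (Cod C f) (Dom C f).
        g \<cdot>\<^bsub>C\<^esub> f = Id C (Dom C f) \<and> f \<cdot>\<^bsub>C\<^esub> g = Id C (Cod C f))"

text \<open>The square \<open>f \<cdot> p = n \<cdot> q\<close> is a pullback; \<open>p\<close> is the pullback of \<open>n\<close> along \<open>f\<close>,
  and \<open>q\<close> is the pullback of \<open>f\<close> along \<open>n\<close>.\<close>

definition is_pullback :: "('o, 'a, 'z) category_scheme \<Rightarrow> 'a \<Rightarrow> 'a \<Rightarrow> 'a \<Rightarrow> 'a \<Rightarrow> bool" where
  "is_pullback C f n p q \<longleftrightarrow>
     f \<in> Arr C \<and> n \<in> Arr C \<and> p \<in> Arr C \<and> q \<in> Arr C \<and>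
     Cod C f = Cod C n \<and> Dom C p = Dom C q \<and> Cod C p = Dom C f \<and> Cod C q = Dom C n \<and>
     f \<cdot>\<^bsub>C\<^esub> p = n \<cdot>\<^bsub>C\<^esub> q \<and>
     (\<forall>W. \<forall>u \<in> Hom C W (Dom C f). \<forall>v \<in> Hom C W (Dom C n).
        f \<cdot>\<^bsub>C\<^esub> u = n \<cdot>\<^bsub>C\<^esub> v \<longrightarrow>
        (\<exists>!w. w \<in> Hom C W (Dom C p) \<and> p \<cdot>\<^bsub>C\<^esub> w = u \<and> q \<cdot>\<^bsub>C\<^esub> w = v))"

definition factors_through :: "('o, 'a, 'z) category_scheme \<Rightarrow> 'a \<Rightarrow> 'a \<Rightarrow> bool" where
  "factors_through C g m \<longleftrightarrow> (\<exists>j \<in> Hom C (Dom C g) (Dom C m). m \<cdot>\<^bsub>C\<^esub> j = g)"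

text \<open>\<open>d\<close> is the intersection (wide pullback) of the set \<open>A\<close> of monomorphisms with codomain \<open>X\<close>.
  The legs of the limit cone are uniquely determined by \<open>d\<close> since the members of \<open>A\<close> are monic,
  so they need not be mentioned.\<close>

definition is_intersection :: "('o, 'a, 'z) category_scheme \<Rightarrow> 'o \<Rightarrow> 'a set \<Rightarrow> 'a \<Rightarrow> bool" where
  "is_intersection C X A d \<longleftrightarrow>
     d \<in> Arr C \<and> Cod C d = X \<and> (\<forall>m \<in> A. factors_through C d m) \<and>
     (\<forall>W. \<forall>g \<in> Hom C W X. (\<forall>m \<in> A. factors_through C g m) \<longrightarrow>
        (\<exists>!h. h \<in> Hom C W (Dom C d) \<and> d \<cdot>\<^bsub>C\<^esub> h = g))"

locale proper_factorization_system = category C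
  for C :: "('o, 'a) em_category" (structure) +
  assumes E_epi: "e \<in> EE C \<Longrightarrow> is_epi C e"
    and M_mono: "m \<in> MM C \<Longrightarrow> is_mono C m"
    and E_iso_closed: "e \<in> EE C \<Longrightarrow> is_iso C h \<Longrightarrow> Dom C h = Cod C e \<Longrightarrow> h \<cdot> e \<in> EE C"
    and M_iso_closed: "m \<in> MM C \<Longrightarrow> is_iso C h \<Longrightarrow> Cod C h = Dom C m \<Longrightarrow> m \<cdot> h \<in> MM C"
    and factorization:
      "f \<in> Arr C \<Longrightarrow> \<exists>m \<in> MM C. \<exists>e \<in> EE C. Cod C e = Dom C m \<and> f = m \<cdot> e"
    and diagonalization:
      "e \<in> EE C \<Longrightarrow> m \<in> MM C \<Longrightarrow>
       u \<in> Hom C (Dom C e) (Dom C m) \<Longrightarrow> v \<in> Hom C (Cod C e) (Cod C m) \<Longrightarrow>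
       m \<cdot> u = v \<cdot> e \<Longrightarrow>
       \<exists>!d. d \<in> Hom C (Cod C e) (Dom C m) \<and> d \<cdot> e = u \<and> m \<cdot> d = v"

locale M_complete_category = proper_factorization_system C
  for C :: "('o, 'a) em_category" (structure) +
  assumes pullback_exists:
      "f \<in> Arr C \<Longrightarrow> n \<in> MM C \<Longrightarrow> Cod C f = Cod C n \<Longrightarrow> \<exists>p q. is_pullback C f n p q"
    and pullback_in_M: "n \<in> MM C \<Longrightarrow> is_pullback C f n p q \<Longrightarrow> p \<in> MM C"
    and intersection_exists:
      "X \<in> Obj C \<Longrightarrow> A \<subseteq> {m \<in> MM C. Cod C m = X} \<Longrightarrow> \<exists>d. is_intersection C X A d"
    and intersection_in_M:
      "X \<in> Obj C \<Longrightarrow> A \<subseteq> {m \<in> MM C. Cod C m = X} \<Longrightarrow> is_intersection C X A d \<Longrightarrow> d \<in> MM C"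

locale E_stable_M_complete_category = M_complete_category C
  for C :: "('o, 'a) em_category" (structure) +
  assumes E_pullback_stable:
    "e \<in> EE C \<Longrightarrow> m \<in> MM C \<Longrightarrow> is_pullback C e m p q \<Longrightarrow> q \<in> EE C"

definition sub_iso :: "('o, 'a) em_category \<Rightarrow> 'o \<Rightarrow> 'a rel" where
  "sub_iso C X = {(m, n). m \<in> MM C \<and> n \<in> MM C \<and> Cod C m = X \<and> Cod C n = X \<and>
     (\<exists>j \<in> Hom C (Dom C m) (Dom C n). is_iso C j \<and> n \<cdot>\<^bsub>C\<^esub> j = m)}"

text \<open>A subobject is an isomorphism class of \<open>\<M>\<close>-morphisms.\<close>

definition Sub :: "('o, 'a) em_category \<Rightarrow> 'o \<Rightarrow> 'a set gorder" where
  "Sub C X =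
     \<lparr>carrier = {m \<in> MM C. Cod C m = X} // sub_iso C X,
      eq = (=),
      le = (\<lambda>P Q. \<exists>m \<in> P. \<exists>n \<in> Q. factors_through C m n)\<rparr>"

text \<open>The set of all \<open>\<M>\<close>-components of \<open>f \<cdot> m\<close>, with \<open>m\<close> ranging over the representatives of \<open>P\<close>,
  and likewise the set of all pullbacks along \<open>f\<close> of representatives of \<open>Q\<close>. As factorizations and
  pullbacks are unique up to isomorphism, these sets are single isomorphism classes.\<close>

definition img :: "('o, 'a) em_category \<Rightarrow> 'a \<Rightarrow> 'a set \<Rightarrow> 'a set" where
  "img C f P = {k \<in> MM C. \<exists>m \<in> P. \<exists>e \<in> EE C.
     Cod C m = Dom C f \<and> Cod C e = Dom C k \<and> f \<cdot>\<^bsub>C\<^esub> m = k \<cdot>\<^bsub>C\<^esub> e}"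

definition preimg :: "('o, 'a) em_category \<Rightarrow> 'a \<Rightarrow> 'a set \<Rightarrow> 'a set" where
  "preimg C f Q = {p. \<exists>n \<in> Q. \<exists>q. is_pullback C f n p q}"

locale pointed_endofunctor = category C
  for C :: "('o, 'a, 'z) category_scheme" (structure) +
  fixes Fo :: "'o \<Rightarrow> 'o" and Fa :: "'a \<Rightarrow> 'a" and \<eta> :: "'o \<Rightarrow> 'a"
  assumes Fo_in_Obj: "X \<in> Obj C \<Longrightarrow> Fo X \<in> Obj C"
    and Fa_in_Hom: "f \<in> Hom C X Y \<Longrightarrow> Fa f \<in> Hom C (Fo X) (Fo Y)"
    and Fa_Id: "X \<in> Obj C \<Longrightarrow> Fa (Id C X) = Id C (Fo X)"
    and Fa_Comp: "f \<in> Hom C X Y \<Longrightarrow> g \<in> Hom C Y Z \<Longrightarrow> Fa (g \<cdot> f) = Fa g \<cdot> Fa f"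
    and eta_in_Hom: "X \<in> Obj C \<Longrightarrow> \<eta> X \<in> Hom C X (Fo X)"
    and eta_natural: "f \<in> Hom C X Y \<Longrightarrow> Fa f \<cdot> \<eta> X = \<eta> Y \<cdot> f"

definition topogenous_order :: "('o, 'a) em_category \<Rightarrow> ('o \<Rightarrow> 'a set rel) \<Rightarrow> bool" where
  "topogenous_order C R \<longleftrightarrow>
     (\<forall>X \<in> Obj C. R X \<subseteq> carrier (Sub C X) \<times> carrier (Sub C X)) \<and>
     (\<forall>X \<in> Obj C. \<forall>m n. (m, n) \<in> R X \<longrightarrow> m \<sqsubseteq>\<^bsub>Sub C X\<^esub> n) \<and>
     (\<forall>X \<in> Obj C. \<forall>m \<in> carrier (Sub C X). \<forall>n p. \<forall>q \<in> carrier (Sub C X).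
        m \<sqsubseteq>\<^bsub>Sub C X\<^esub> n \<and> (n, p) \<in> R X \<and> p \<sqsubseteq>\<^bsub>Sub C X\<^esub> q \<longrightarrow> (m, q) \<in> R X) \<and>
     (\<forall>X Y. \<forall>f \<in> Hom C X Y. \<forall>m n.
        (m, n) \<in> R Y \<longrightarrow> (preimg C f m, preimg C f n) \<in> R X)"

definition meet_preserving :: "('o, 'a) em_category \<Rightarrow> ('o \<Rightarrow> 'a set rel) \<Rightarrow> bool" where
  "meet_preserving C R \<longleftrightarrow>
     (\<forall>X \<in> Obj C. \<forall>m \<in> carrier (Sub C X). \<forall>N \<subseteq> carrier (Sub C X).
        (\<forall>n \<in> N. (m, n) \<in> R X) \<longrightarrow> (m, \<Sqinter>\<^bsub>Sub C X\<^esub> N) \<in> R X)"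

definition interpolative :: "('o, 'a) em_category \<Rightarrow> ('o \<Rightarrow> 'a set rel) \<Rightarrow> bool" where
  "interpolative C R \<longleftrightarrow>
     (\<forall>X \<in> Obj C. \<forall>m n. (m, n) \<in> R X \<longrightarrow> (\<exists>p. (m, p) \<in> R X \<and> (p, n) \<in> R X))"

text \<open>\<open>R\<close> is the topogenous order determined by \<open>S\<close>.\<close>

definition simple_coperfect_syntopogenous ::
    "('o, 'a) em_category \<Rightarrow> ('o \<Rightarrow> 'a set rel set) \<Rightarrow> ('o \<Rightarrow> 'a set rel) \<Rightarrow> bool" where
  "simple_coperfect_syntopogenous C S R \<longleftrightarrow>
     (\<forall>X \<in> Obj C. S X = {R X}) \<and>
     topogenous_order C R \<and> meet_preserving C R \<and> interpolative C R"

definition clo_of :: "('o, 'a) em_category \<Rightarrow> ('o \<Rightarrow> 'a set rel) \<Rightarrow> 'o \<Rightarrow> 'a set \<Rightarrow> 'a set" where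
  "clo_of C R X m = \<Sqinter>\<^bsub>Sub C X\<^esub> {p. (m, p) \<in> R X}"

definition closure_operator ::
    "('o, 'a) em_category \<Rightarrow> ('o \<Rightarrow> 'a set \<Rightarrow> 'a set) \<Rightarrow> bool" where
  "closure_operator C c \<longleftrightarrow>
     (\<forall>X \<in> Obj C. c X \<in> carrier (Sub C X) \<rightarrow> carrier (Sub C X)) \<and>
     (\<forall>X \<in> Obj C. \<forall>m \<in> carrier (Sub C X). m \<sqsubseteq>\<^bsub>Sub C X\<^esub> c X m) \<and>
     (\<forall>X \<in> Obj C. \<forall>m \<in> carrier (Sub C X). \<forall>n \<in> carrier (Sub C X).
        m \<sqsubseteq>\<^bsub>Sub C X\<^esub> n \<longrightarrow> c X m \<sqsubseteq>\<^bsub>Sub C X\<^esub> c X n) \<and>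
     (\<forall>X Y. \<forall>f \<in> Hom C X Y. \<forall>m \<in> carrier (Sub C X).
        img C f (c X m) \<sqsubseteq>\<^bsub>Sub C Y\<^esub> c Y (img C f m))"

definition idempotent_closure ::
    "('o, 'a) em_category \<Rightarrow> ('o \<Rightarrow> 'a set \<Rightarrow> 'a set) \<Rightarrow> bool" where
  "idempotent_closure C c \<longleftrightarrow>
     (\<forall>X \<in> Obj C. Idem\<^bsub>Sub C X\<^esub> (c X))"

definition closure_le ::
    "('o, 'a) em_category \<Rightarrow> ('o \<Rightarrow> 'a set \<Rightarrow> 'a set) \<Rightarrow> ('o \<Rightarrow> 'a set \<Rightarrow> 'a set) \<Rightarrow> bool" where
  "closure_le C c c' \<longleftrightarrow>
     (\<forall>X \<in> Obj C. \<forall>m \<in> carrier (Sub C X). c X m \<sqsubseteq>\<^bsub>Sub C X\<^esub> c' X m)"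

definition closure_continuous ::
    "('o, 'a) em_category \<Rightarrow> ('o \<Rightarrow> 'a set \<Rightarrow> 'a set) \<Rightarrow> ('o \<Rightarrow> 'a set \<Rightarrow> 'a set) \<Rightarrow> 'a \<Rightarrow> bool" where
  "closure_continuous C c c' f \<longleftrightarrow>
     (\<forall>m \<in> carrier (Sub C (Dom C f)).
        img C f (c (Dom C f) m) \<sqsubseteq>\<^bsub>Sub C (Cod C f)\<^esub> c' (Cod C f) (img C f m))"

end

theory Submission
  imports Defs
begin

text \<open>Write \<open>c\<close> for the closure of the \<open>\<Sqinter>\<close>-preserving order \<open>\<sqsubset>\<close>. Meet preservation makes
  \<open>m \<sqsubset> n\<close> equivalent to \<open>c m \<le> n\<close>, so that (T3), transposed along the adjunction of image and
  preimage, is (C3) for \<open>c\<close>, and interpolation is idempotency. As \<open>\<eta> (d m) \<le> c (\<eta> m)\<close> is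
  equivalent to \<open>d m \<le> \<eta>\<^sup>-\<^sup>1 (c (\<eta> m))\<close>, the operator in question is the largest candidate; (C3)
  for it follows from (C3) for \<open>c\<close> at \<open>F f\<close>, by naturality of \<open>\<eta>\<close>.\<close>

section \<open>Composition, factoring through a morphism, and pullbacks\<close>

lemma HomI: "f \<in> Arr C \<Longrightarrow> f \<in> Hom C (Dom C f) (Cod C f)"
  by (simp add: Hom_def)

lemma HomD:
  assumes "f \<in> Hom C X Y"
  shows "f \<in> Arr C" "Dom C f = X" "Cod C f = Y"
  using assms by (auto simp: Hom_def)

context category
begin

lemma Hom_Obj:
  assumes "f \<in> Hom C X Y"
  shows "X \<in> Obj C" "Y \<in> Obj C"
  using assms Dom_in_Obj Cod_in_Obj by (auto simp: Hom_def)

lemma factors_through_refl: "m \<in> Arr C \<Longrightarrow> factors_through C m m"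
  unfolding factors_through_def
  using HomI[of m C] Id_right Id_in_Hom Hom_Obj by blast

lemma factors_through_trans:
  assumes "factors_through C g m" "factors_through C m n" "n \<in> Arr C"
  shows "factors_through C g n"
proof -
  obtain j where j: "j \<in> Hom C (Dom C g) (Dom C m)" "m \<cdot> j = g"
    using assms(1) by (auto simp: factors_through_def)
  obtain k where k: "k \<in> Hom C (Dom C m) (Dom C n)" "n \<cdot> k = m"
    using assms(2) by (auto simp: factors_through_def)
  have "n \<cdot> (k \<cdot> j) = g"
    using Comp_assoc[OF j(1) k(1) HomI[OF assms(3)]] j k by simp
  then show ?thesis
    using Comp_in_Hom[OF j(1) k(1)] by (auto simp: factors_through_def)
qed

lemma factors_through_comp_left:
  assumes "factors_through C g m" "m \<in> Hom C U X" "f \<in> Hom C X Y"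
  shows "factors_through C (f \<cdot> g) (f \<cdot> m)"
proof -
  obtain j where j: "j \<in> Hom C (Dom C g) U" "m \<cdot> j = g"
    using assms(1) HomD[OF assms(2)] by (auto simp: factors_through_def)
  have "(f \<cdot> m) \<cdot> j = f \<cdot> g"
    using Comp_assoc[OF j(1) assms(2,3)] j by simp
  moreover have "Dom C (f \<cdot> g) = Dom C g" "Dom C (f \<cdot> m) = U"
    using HomD Comp_in_Hom[OF assms(2,3)] Comp_in_Hom[OF Comp_in_Hom[OF j(1) assms(2)] assms(3)] j
    by auto
  ultimately show ?thesis
    using j(1) by (auto simp: factors_through_def)
qed

text \<open>From right to left, the universal property supplies the factorization; only the
  existence of the mediating arrow enters. This is the adjunction of image and preimage at the level
  of representatives.\<close>

lemma is_pullback_factors_iff: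
  assumes "is_pullback C f n p q" "g \<in> Hom C W (Dom C f)"
  shows "factors_through C g p \<longleftrightarrow> factors_through C (f \<cdot> g) n"
proof -
  have arr: "f \<in> Arr C" "n \<in> Arr C" "p \<in> Arr C" "q \<in> Arr C"
    and sq: "Cod C f = Cod C n" "Dom C p = Dom C q" "Cod C p = Dom C f" "Cod C q = Dom C n"
      "f \<cdot> p = n \<cdot> q"
    and univ: "\<And>W u v. u \<in> Hom C W (Dom C f) \<Longrightarrow> v \<in> Hom C W (Dom C n) \<Longrightarrow> f \<cdot> u = n \<cdot> v
      \<Longrightarrow> \<exists>w. w \<in> Hom C W (Dom C p) \<and> p \<cdot> w = u \<and> q \<cdot> w = v"
    using assms(1) unfolding is_pullback_def by blast+
  have hp: "p \<in> Hom C (Dom C p) (Dom C f)" and hq: "q \<in> Hom C (Dom C p) (Dom C n)"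
    and hf: "f \<in> Hom C (Dom C f) (Cod C n)" and hn: "n \<in> Hom C (Dom C n) (Cod C n)"
    using arr sq by (auto simp: Hom_def)
  have dg: "Dom C g = W" and dfg: "Dom C (f \<cdot> g) = W"
    using HomD(2)[OF assms(2)] HomD(2)[OF Comp_in_Hom[OF assms(2) hf]] by auto
  show ?thesis
  proof
    assume "factors_through C g p"
    then obtain w where w: "w \<in> Hom C W (Dom C p)" "p \<cdot> w = g"
      using dg by (auto simp: factors_through_def)
    have "n \<cdot> (q \<cdot> w) = f \<cdot> g"
      using Comp_assoc[OF w(1) hq hn] Comp_assoc[OF w(1) hp hf] sq w by simp
    then show "factors_through C (f \<cdot> g) n"
      using Comp_in_Hom[OF w(1) hq] dfg by (auto simp: factors_through_def)
  next
    assume "factors_through C (f \<cdot> g) n"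
    then obtain v where "v \<in> Hom C W (Dom C n)" "n \<cdot> v = f \<cdot> g"
      using dfg by (auto simp: factors_through_def)
    then show "factors_through C g p"
      using univ[OF assms(2)] dg unfolding factors_through_def by metis
  qed
qed

lemma is_iso_inverse:
  assumes "j \<in> Hom C X Y" "is_iso C j"
  obtains i where "i \<in> Hom C Y X" "is_iso C i" "i \<cdot> j = Id C X" "j \<cdot> i = Id C Y"
  using assms unfolding is_iso_def Hom_def by fastforce

text \<open>If \<open>w\<close> mediates into the old pullback and \<open>i\<close> is inverse to
  \<open>j\<close>, then \<open>i \<cdot> w\<close> mediates into the new one. The lemma serves to
  show that \<open>preimg C f Q\<close> is a whole isomorphism class.\<close>

lemma is_pullback_iso:
  assumes pb: "is_pullback C f n p q" and j: "j \<in> Hom C V (Dom C p)" "is_iso C j"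
  shows "is_pullback C f n (p \<cdot> j) (q \<cdot> j)"
proof -
  have arr: "f \<in> Arr C" "n \<in> Arr C" "p \<in> Arr C" "q \<in> Arr C"
    and sq: "Cod C f = Cod C n" "Dom C p = Dom C q" "Cod C p = Dom C f" "Cod C q = Dom C n"
      "f \<cdot> p = n \<cdot> q"
    and univ: "\<And>W u v. u \<in> Hom C W (Dom C f) \<Longrightarrow> v \<in> Hom C W (Dom C n) \<Longrightarrow> f \<cdot> u = n \<cdot> v
      \<Longrightarrow> \<exists>!w. w \<in> Hom C W (Dom C p) \<and> p \<cdot> w = u \<and> q \<cdot> w = v"
    using pb unfolding is_pullback_def by blast+
  have hp: "p \<in> Hom C (Dom C p) (Dom C f)" and hq: "q \<in> Hom C (Dom C p) (Dom C n)"
    and hf: "f \<in> Hom C (Dom C f) (Cod C n)" and hn: "n \<in> Hom C (Dom C n) (Cod C n)"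
    using arr sq by (auto simp: Hom_def)
  have hpj: "p \<cdot> j \<in> Hom C V (Dom C f)" and hqj: "q \<cdot> j \<in> Hom C V (Dom C n)"
    using Comp_in_Hom j hp hq by blast+
  obtain i where i: "i \<in> Hom C (Dom C p) V" "i \<cdot> j = Id C V" "j \<cdot> i = Id C (Dom C p)"
    using is_iso_inverse[OF j] by metis
  have "\<exists>!w. w \<in> Hom C W V \<and> (p \<cdot> j) \<cdot> w = u \<and> (q \<cdot> j) \<cdot> w = v"
    if uv: "u \<in> Hom C W (Dom C f)" "v \<in> Hom C W (Dom C n)" "f \<cdot> u = n \<cdot> v" for W u v
  proof -
    obtain w where w: "w \<in> Hom C W (Dom C p)" "p \<cdot> w = u" "q \<cdot> w = v"
      and uniq: "\<And>w'. w' \<in> Hom C W (Dom C p) \<Longrightarrow> p \<cdot> w' = u \<Longrightarrow> q \<cdot> w' = v \<Longrightarrow> w' = w"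
      using univ[OF uv] by metis
    show ?thesis
    proof (rule ex1I[of _ "i \<cdot> w"])
      have "j \<cdot> (i \<cdot> w) = w"
        using Comp_assoc[OF w(1) i(1) j(1)] i(3) Id_left[OF w(1)] by simp
      then show "i \<cdot> w \<in> Hom C W V \<and> (p \<cdot> j) \<cdot> (i \<cdot> w) = u \<and> (q \<cdot> j) \<cdot> (i \<cdot> w) = v"
        using Comp_in_Hom[OF w(1) i(1)] Comp_assoc[OF _ j(1) hp] Comp_assoc[OF _ j(1) hq] w by metis
    next
      fix w' assume w': "w' \<in> Hom C W V \<and> (p \<cdot> j) \<cdot> w' = u \<and> (q \<cdot> j) \<cdot> w' = v"
      then have "j \<cdot> w' = w"
        using uniq Comp_in_Hom[OF _ j(1)] Comp_assoc[OF _ j(1) hp] Comp_assoc[OF _ j(1) hq] by metis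
      then show "w' = i \<cdot> w"
        using Comp_assoc[OF _ j(1) i(1)] i(2) Id_left w' by metis
    qed
  qed
  moreover have "f \<cdot> (p \<cdot> j) = n \<cdot> (q \<cdot> j)"
    using Comp_assoc[OF j(1) hp hf] Comp_assoc[OF j(1) hq hn] sq by simp
  ultimately show ?thesis
    using arr sq(1) HomD[OF hpj] HomD[OF hqj] unfolding is_pullback_def by simp
qed

end

section \<open>The partially ordered set of subobjects\<close>

context proper_factorization_system
begin

lemma M_Hom: "m \<in> MM C \<Longrightarrow> m \<in> Hom C (Dom C m) (Cod C m)"
  using M_mono by (simp add: is_mono_def HomI)

lemma M_Arr: "m \<in> MM C \<Longrightarrow> m \<in> Arr C"
  by (rule HomD(1)[OF M_Hom])

lemma M_cancel:
  assumes "m \<in> MM C" "g \<in> Hom C W (Dom C m)" "h \<in> Hom C W (Dom C m)" "m \<cdot> g = m \<cdot> h"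
  shows "g = h"
  using assms M_mono unfolding is_mono_def by blast

text \<open>If \<open>m\<close> and \<open>n\<close> factor through each other by \<open>j\<close>
  and \<open>i\<close>, cancelling the monomorphisms \<open>m\<close> and \<open>n\<close> shows
  that \<open>i \<cdot> j\<close> and \<open>j \<cdot> i\<close> are identities. Hence isomorphism
  of subobjects is the equivalence induced by the preorder \<open>factors_through\<close>.\<close>

lemma sub_iso_iff:
  "(m, n) \<in> sub_iso C X \<longleftrightarrow> m \<in> MM C \<and> n \<in> MM C \<and> Cod C m = X \<and> Cod C n = X \<and>
     factors_through C m n \<and> factors_through C n m"
proof (cases "m \<in> MM C \<and> n \<in> MM C \<and> Cod C m = X \<and> Cod C n = X")
  case True
  then have m: "m \<in> Hom C (Dom C m) X" and n: "n \<in> Hom C (Dom C n) X"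
    using M_Hom[of m] M_Hom[of n] by auto
  have "(\<exists>j \<in> Hom C (Dom C m) (Dom C n). is_iso C j \<and> n \<cdot> j = m) \<longleftrightarrow>
        factors_through C m n \<and> factors_through C n m"
  proof
    assume "\<exists>j \<in> Hom C (Dom C m) (Dom C n). is_iso C j \<and> n \<cdot> j = m"
    then obtain j where j: "j \<in> Hom C (Dom C m) (Dom C n)" "is_iso C j" "n \<cdot> j = m"
      by blast
    then have mn: "factors_through C m n"
      by (auto simp: factors_through_def)
    obtain i where i: "i \<in> Hom C (Dom C n) (Dom C m)" "j \<cdot> i = Id C (Dom C n)"
      using is_iso_inverse[OF j(1,2)] by metis
    have "m \<cdot> i = n"
      using Comp_assoc[OF i(1) j(1) n] j(3) i(2) Id_right[OF n] by simp
    then have "factors_through C n m"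
      using i(1) by (auto simp: factors_through_def)
    with mn show "factors_through C m n \<and> factors_through C n m" ..
  next
    assume "factors_through C m n \<and> factors_through C n m"
    then obtain j i where j: "j \<in> Hom C (Dom C m) (Dom C n)" "n \<cdot> j = m"
      and i: "i \<in> Hom C (Dom C n) (Dom C m)" "m \<cdot> i = n"
      by (auto simp: factors_through_def)
    have "i \<cdot> j = Id C (Dom C m)"
      using M_cancel[of m "i \<cdot> j" "Dom C m" "Id C (Dom C m)"] True Comp_assoc[OF j(1) i(1) m] i j
        Id_right[OF m] Comp_in_Hom[OF j(1) i(1)] Id_in_Hom Hom_Obj[OF m] by simp
    moreover have "j \<cdot> i = Id C (Dom C n)"
      using M_cancel[of n "j \<cdot> i" "Dom C n" "Id C (Dom C n)"] True Comp_assoc[OF i(1) j(1) n] i j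
        Id_right[OF n] Comp_in_Hom[OF i(1) j(1)] Id_in_Hom Hom_Obj[OF n] by simp
    ultimately have "is_iso C j"
      using HomD[OF j(1)] i(1) by (auto simp: is_iso_def)
    then show "\<exists>j \<in> Hom C (Dom C m) (Dom C n). is_iso C j \<and> n \<cdot> j = m"
      using j by blast
  qed
  then show ?thesis
    using True by (simp add: sub_iso_def)
qed (auto simp: sub_iso_def)

lemma equiv_sub_iso: "equiv {m \<in> MM C. Cod C m = X} (sub_iso C X)"
proof (rule equivI)
  show "refl_on {m \<in> MM C. Cod C m = X} (sub_iso C X)"
    by (auto simp: refl_on_def sub_iso_iff factors_through_refl M_Arr)
  show "sym (sub_iso C X)"
    by (auto simp: sym_def sub_iso_iff)
  show "trans (sub_iso C X)"
    using factors_through_trans M_Arr unfolding trans_def sub_iso_iff by blast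
qed (auto simp: sub_iso_iff)

lemma carrier_Sub: "carrier (Sub C X) = {m \<in> MM C. Cod C m = X} // sub_iso C X"
  by (simp add: Sub_def)

lemma class_in_Sub: "m \<in> MM C \<Longrightarrow> Cod C m = X \<Longrightarrow> sub_iso C X `` {m} \<in> carrier (Sub C X)"
  by (simp add: carrier_Sub quotientI)

lemma Sub_E:
  assumes "P \<in> carrier (Sub C X)"
  obtains m where "m \<in> P" "m \<in> Hom C (Dom C m) X" "X \<in> Obj C"
proof -
  obtain m where "m \<in> MM C" "Cod C m = X" "P = sub_iso C X `` {m}"
    using assms by (auto simp: carrier_Sub elim: quotientE)
  then show ?thesis
    using that[of m] M_Hom[of m] Hom_Obj(2)[OF M_Hom[of m]]
      equiv_class_self[OF equiv_sub_iso, of m X] by simp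
qed

text \<open>Equivalent elements generate the same class, so every member may serve as the
  representative, not just the one with which the quotient was formed.\<close>

lemma Sub_mem:
  assumes "P \<in> carrier (Sub C X)" "m \<in> P"
  shows "m \<in> MM C" "Cod C m = X" "m \<in> Hom C (Dom C m) X" "P = sub_iso C X `` {m}"
proof -
  show "m \<in> MM C" "Cod C m = X"
    using assms in_quotient_imp_subset[OF equiv_sub_iso] by (auto simp: carrier_Sub)
  then show "m \<in> Hom C (Dom C m) X"
    using M_Hom[of m] by simp
  obtain k where "P = sub_iso C X `` {k}"
    using assms(1) by (auto simp: carrier_Sub elim: quotientE)
  then show "P = sub_iso C X `` {m}"
    using assms(2) equiv_class_eq[OF equiv_sub_iso] by simp
qed

text \<open>The order of \<open>Sub\<close> asks for some pair of representatives. Since members of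
  one class factor through each other, every pair gives the same answer, and proofs can compare
  whichever representatives are at hand.\<close>

lemma Sub_le_iff:
  assumes "P \<in> carrier (Sub C X)" "Q \<in> carrier (Sub C X)" "m \<in> P" "n \<in> Q"
  shows "P \<sqsubseteq>\<^bsub>Sub C X\<^esub> Q \<longleftrightarrow> factors_through C m n"
proof
  assume "P \<sqsubseteq>\<^bsub>Sub C X\<^esub> Q"
  then obtain m' n' where h: "m' \<in> P" "n' \<in> Q" "factors_through C m' n'"
    by (auto simp: Sub_def)
  have "(m, m') \<in> sub_iso C X" "(n', n) \<in> sub_iso C X"
    using h Sub_mem(4)[OF assms(1,3)] Sub_mem(4)[OF assms(2) h(2)] assms(4) by auto
  then show "factors_through C m n"
    using h(3) factors_through_trans M_Arr by (meson sub_iso_iff)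
qed (use assms in \<open>auto simp: Sub_def\<close>)

text \<open>Reflexivity and transitivity are inherited from \<open>factors_through\<close>.
  Antisymmetry comes from passing to classes: mutual factorization is \<open>sub_iso\<close>, and
  related morphisms have equal classes.\<close>

lemma partial_order_Sub: "partial_order (Sub C X)"
proof -
  have eq: "(.=\<^bsub>Sub C X\<^esub>) = (=)"
    by (simp add: Sub_def)
  show ?thesis
  proof (unfold_locales, unfold eq)
    fix P assume "P \<in> carrier (Sub C X)"
    then show "P \<sqsubseteq>\<^bsub>Sub C X\<^esub> P"
      using Sub_le_iff factors_through_refl M_Arr Sub_mem(1) Sub_E by metis
  next
    fix P Q assume P: "P \<in> carrier (Sub C X)" and Q: "Q \<in> carrier (Sub C X)"
      and le: "P \<sqsubseteq>\<^bsub>Sub C X\<^esub> Q" "Q \<sqsubseteq>\<^bsub>Sub C X\<^esub> P"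
    obtain m n where mn: "m \<in> P" "n \<in> Q"
      using P Q Sub_E by metis
    then have "(m, n) \<in> sub_iso C X"
      using le Sub_mem[OF P] Sub_mem[OF Q] Sub_le_iff[OF P Q] Sub_le_iff[OF Q P]
      by (simp add: sub_iso_iff)
    then show "P = Q"
      using mn Sub_mem(4)[OF P] Sub_mem(4)[OF Q] equiv_class_eq[OF equiv_sub_iso] by metis
  next
    fix P Q N
    assume h: "P \<in> carrier (Sub C X)" "Q \<in> carrier (Sub C X)" "N \<in> carrier (Sub C X)"
      "P \<sqsubseteq>\<^bsub>Sub C X\<^esub> Q" "Q \<sqsubseteq>\<^bsub>Sub C X\<^esub> N"
    obtain m n k where mnk: "m \<in> P" "n \<in> Q" "k \<in> N"
      using h Sub_E by metis
    then have "factors_through C m n" "factors_through C n k"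
      using h Sub_le_iff[OF h(1,2)] Sub_le_iff[OF h(2,3)] by blast+
    then have "factors_through C m k"
      using factors_through_trans M_Arr Sub_mem(1)[OF h(3) mnk(3)] by blast
    then show "P \<sqsubseteq>\<^bsub>Sub C X\<^esub> N"
      using Sub_le_iff[OF h(1,3)] mnk by blast
  qed auto
qed

lemma Sub_trans:
  assumes "P \<in> carrier (Sub C X)" "Q \<in> carrier (Sub C X)" "N \<in> carrier (Sub C X)"
    "P \<sqsubseteq>\<^bsub>Sub C X\<^esub> Q" "Q \<sqsubseteq>\<^bsub>Sub C X\<^esub> N"
  shows "P \<sqsubseteq>\<^bsub>Sub C X\<^esub> N"
proof -
  interpret partial_order "Sub C X" by (rule partial_order_Sub)
  show ?thesis by (rule le_trans[OF assms(4,5,1,2,3)])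
qed

lemma Sub_refl: "P \<in> carrier (Sub C X) \<Longrightarrow> P \<sqsubseteq>\<^bsub>Sub C X\<^esub> P"
proof -
  interpret partial_order "Sub C X" by (rule partial_order_Sub)
  show "P \<in> carrier (Sub C X) \<Longrightarrow> P \<sqsubseteq>\<^bsub>Sub C X\<^esub> P" by simp
qed

lemma Sub_antisym:
  assumes "P \<in> carrier (Sub C X)" "Q \<in> carrier (Sub C X)"
    "P \<sqsubseteq>\<^bsub>Sub C X\<^esub> Q" "Q \<sqsubseteq>\<^bsub>Sub C X\<^esub> P"
  shows "P = Q"
proof -
  interpret partial_order "Sub C X" by (rule partial_order_Sub)
  show ?thesis by (rule le_antisym[OF assms(3,4,1,2)])
qed

section \<open>Images of subobjects\<close>

lemma E_M_orthogonal:
  assumes "e \<in> EE C" "Cod C e = Dom C k" "k \<in> Hom C (Dom C k) Y" "n \<in> MM C" "Cod C n = Y"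
  shows "factors_through C (k \<cdot> e) n \<longleftrightarrow> factors_through C k n"
proof -
  have e: "e \<in> Hom C (Dom C e) (Dom C k)"
    using E_epi[OF assms(1)] assms(2) by (auto simp: is_epi_def Hom_def)
  have n: "n \<in> Hom C (Dom C n) Y"
    using M_Hom[OF assms(4)] assms(5) by simp
  have d: "Dom C (k \<cdot> e) = Dom C e"
    using HomD(2)[OF Comp_in_Hom[OF e assms(3)]] .
  show ?thesis
  proof
    assume "factors_through C (k \<cdot> e) n"
    then obtain u where "u \<in> Hom C (Dom C e) (Dom C n)" "n \<cdot> u = k \<cdot> e"
      using d by (auto simp: factors_through_def)
    \<comment> \<open>The square \<open>n \<cdot> u = k \<cdot> e\<close> has \<open>e\<close> in
      \<open>EE C\<close> and \<open>n\<close> in \<open>MM C\<close>; its diagonal \<open>d\<close>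
      satisfies \<open>n \<cdot> d = k\<close>.\<close>
    then show "factors_through C k n"
      using diagonalization[OF assms(1,4), of u k] assms by (auto simp: factors_through_def)
  next
    assume "factors_through C k n"
    then show "factors_through C (k \<cdot> e) n"
      using factors_through_trans[of "k \<cdot> e" k n] M_Arr[OF assms(4)] e d
      by (auto simp: factors_through_def)
  qed
qed

text \<open>Here \<open>k\<close> arises from a possibly different representative \<open>m'\<close>,
  with \<open>f \<cdot> m' = k \<cdot> e\<close>. As \<open>m\<close> and \<open>m'\<close> factor
  through each other, so do their composites with \<open>f\<close>, and orthogonality removes
  \<open>e\<close>. Thus \<open>k\<close> is least among the M-morphisms through which
  \<open>f \<cdot> m\<close> factors.\<close>

lemma img_factors:
  assumes f: "f \<in> Hom C X Y" and P: "P \<in> carrier (Sub C X)" and m: "m \<in> P"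
    and k: "k \<in> img C f P" and n: "n \<in> MM C" "Cod C n = Y"
  shows "factors_through C k n \<longleftrightarrow> factors_through C (f \<cdot> m) n"
proof -
  obtain m' e where h: "m' \<in> P" "e \<in> EE C" "Cod C e = Dom C k" "f \<cdot> m' = k \<cdot> e" "k \<in> MM C"
    using k by (auto simp: img_def)
  have e: "e \<in> Hom C (Dom C e) (Dom C k)"
    using E_epi[OF h(2)] h(3) by (auto simp: is_epi_def Hom_def)
  have fm: "f \<cdot> m \<in> Hom C (Dom C m) Y" "f \<cdot> m' \<in> Hom C (Dom C m') Y"
    using Comp_in_Hom[OF _ f] Sub_mem(3)[OF P] m h(1) by blast+
  have "Cod C k = Y"
    using Comp_in_Hom[OF e M_Hom[OF h(5)]] fm(2) h(4) HomD(3) by metis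
  then have kH: "k \<in> Hom C (Dom C k) Y"
    using M_Hom[OF h(5)] by simp
  have "factors_through C m m'" "factors_through C m' m"
    using Sub_le_iff[OF P P] Sub_refl[OF P] m h(1) by blast+
  then have "factors_through C (f \<cdot> m) (f \<cdot> m')" "factors_through C (f \<cdot> m') (f \<cdot> m)"
    using factors_through_comp_left[OF _ _ f] Sub_mem(3)[OF P] m h(1) by blast+
  then have "factors_through C (f \<cdot> m) n \<longleftrightarrow> factors_through C (f \<cdot> m') n"
    using factors_through_trans M_Arr[OF n(1)] by metis
  then show ?thesis
    using E_M_orthogonal[OF h(2,3) kH n] h(4) by simp
qed

text \<open>Any two members of \<open>img C f P\<close> have the universal property of
  \<open>img_factors\<close>, hence factor through each other. Conversely, an isomorphic copy of a
  member is again one, because the isomorphism can be absorbed into the \<open>EE C\<close> part of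
  the factorization.\<close>

lemma img_in_Sub:
  assumes f: "f \<in> Hom C X Y" and P: "P \<in> carrier (Sub C X)"
  shows "img C f P \<in> carrier (Sub C Y)"
proof -
  have Cod: "Cod C k = Y" if k: "k \<in> img C f P" for k
  proof -
    obtain m e where h: "m \<in> P" "e \<in> EE C" "Cod C e = Dom C k" "f \<cdot> m = k \<cdot> e" "k \<in> MM C"
      using k by (auto simp: img_def)
    have e: "e \<in> Hom C (Dom C e) (Dom C k)"
      using E_epi[OF h(2)] h(3) by (auto simp: is_epi_def Hom_def)
    show ?thesis
      using Comp_in_Hom[OF e M_Hom[OF h(5)]] Comp_in_Hom[OF Sub_mem(3)[OF P h(1)] f] h(4) HomD(3)
      by metis
  qed
  obtain m where m: "m \<in> P"
    using P Sub_E by metis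
  have fm: "f \<cdot> m \<in> Hom C (Dom C m) Y"
    using Comp_in_Hom[OF Sub_mem(3)[OF P m] f] .
  obtain k e where k: "k \<in> MM C" "e \<in> EE C" "Cod C e = Dom C k" "f \<cdot> m = k \<cdot> e"
    using factorization HomD(1)[OF fm] by metis
  have Cm: "Cod C m = Dom C f"
    using Sub_mem(2)[OF P m] HomD(2)[OF f] by simp
  then have k_img: "k \<in> img C f P"
    using k m by (auto simp: img_def)
  have e: "e \<in> Hom C (Dom C e) (Dom C k)"
    using E_epi[OF k(2)] k(3) by (auto simp: is_epi_def Hom_def)
  have "img C f P = sub_iso C Y `` {k}"
  proof (intro equalityI subsetI)
    fix l assume l: "l \<in> img C f P"
    then have "l \<in> MM C"
      by (simp add: img_def)
    moreover have "factors_through C k l" "factors_through C l k"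
      using img_factors[OF f P m k_img] img_factors[OF f P m l] Cod[OF l] Cod[OF k_img] k(1)
        factors_through_refl M_Arr calculation by metis+
    ultimately show "l \<in> sub_iso C Y `` {k}"
      using Cod[OF l] Cod[OF k_img] k(1) by (simp add: sub_iso_iff)
  next
    fix l assume "l \<in> sub_iso C Y `` {k}"
    then obtain j where j: "l \<in> MM C" "Cod C l = Y" "j \<in> Hom C (Dom C k) (Dom C l)"
      "is_iso C j" "l \<cdot> j = k"
      by (auto simp: sub_iso_def)
    have "j \<cdot> e \<in> EE C" "Cod C (j \<cdot> e) = Dom C l"
      using E_iso_closed[OF k(2) j(4)] HomD[OF j(3)] k(3) HomD[OF Comp_in_Hom[OF e j(3)]] by auto
    moreover have "f \<cdot> m = l \<cdot> (j \<cdot> e)"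
      using Comp_assoc[OF e j(3) M_Hom[OF j(1)]] k(4) j(5) by simp
    ultimately show "l \<in> img C f P"
      using j(1) m Cm by (auto simp: img_def)
  qed
  then show ?thesis
    using class_in_Sub k(1) Cod[OF k_img] by simp
qed

text \<open>This tests an image from above without naming one of its representatives; later facts
  about images rest on it.\<close>

lemma img_le_iff:
  assumes "f \<in> Hom C X Y" "P \<in> carrier (Sub C X)" "Q \<in> carrier (Sub C Y)" "m \<in> P" "n \<in> Q"
  shows "img C f P \<sqsubseteq>\<^bsub>Sub C Y\<^esub> Q \<longleftrightarrow> factors_through C (f \<cdot> m) n"
proof -
  obtain k where "k \<in> img C f P"
    using Sub_E[OF img_in_Sub[OF assms(1,2)]] by metis
  then show ?thesis
    using Sub_le_iff[OF img_in_Sub[OF assms(1,2)] assms(3)] assms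
      img_factors[OF assms(1,2,4)] Sub_mem by metis
qed

text \<open>Both sides lie below the same subobjects \<open>Q\<close>, so antisymmetry identifies
  them. For the comparison, a factorization \<open>f \<cdot> m = k \<cdot> e\<close> gives
  \<open>(g \<cdot> f) \<cdot> m = (g \<cdot> k) \<cdot> e\<close>, and orthogonality removes
  \<open>e\<close>. This functoriality turns naturality of \<eta> into an equation between
  images.\<close>

lemma img_comp:
  assumes f: "f \<in> Hom C X Y" and g: "g \<in> Hom C Y Z" and P: "P \<in> carrier (Sub C X)"
  shows "img C (g \<cdot> f) P = img C g (img C f P)"
proof -
  have gf: "g \<cdot> f \<in> Hom C X Z"
    using Comp_in_Hom[OF f g] .
  have fP: "img C f P \<in> carrier (Sub C Y)"
    using img_in_Sub[OF f P] .
  have iff: "img C (g \<cdot> f) P \<sqsubseteq>\<^bsub>Sub C Z\<^esub> Q \<longleftrightarrow> img C g (img C f P) \<sqsubseteq>\<^bsub>Sub C Z\<^esub> Q"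
    if Q: "Q \<in> carrier (Sub C Z)" for Q
  proof -
    obtain n where n: "n \<in> Q"
      using Sub_E[OF Q] by metis
    obtain k where k: "k \<in> img C f P"
      using Sub_E[OF fP] by metis
    then obtain m e where h: "m \<in> P" "e \<in> EE C" "Cod C e = Dom C k" "f \<cdot> m = k \<cdot> e"
      by (auto simp: img_def)
    have e: "e \<in> Hom C (Dom C e) (Dom C k)"
      using E_epi[OF h(2)] h(3) by (auto simp: is_epi_def Hom_def)
    have kH: "k \<in> Hom C (Dom C k) Y" and mH: "m \<in> Hom C (Dom C m) X"
      using Sub_mem(3) fP k P h(1) by blast+
    have gk: "g \<cdot> k \<in> Hom C (Dom C k) Z" "Dom C (g \<cdot> k) = Dom C k"
      using Comp_in_Hom[OF kH g] HomD(2)[OF Comp_in_Hom[OF kH g]] by auto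
    have "(g \<cdot> f) \<cdot> m = (g \<cdot> k) \<cdot> e"
      using Comp_assoc[OF mH f g] Comp_assoc[OF e kH g] h(4) by simp
    then show ?thesis
      using img_le_iff[OF gf P Q h(1) n] img_le_iff[OF g fP Q k n]
        E_M_orthogonal[OF h(2), of "g \<cdot> k" Z n] gk h(3) Sub_mem[OF Q n] by simp
  qed
  show ?thesis
    using iff Sub_refl Sub_antisym img_in_Sub[OF gf P] img_in_Sub[OF g fP] by metis
qed

end

section \<open>Preimages, their adjunction with images, and meets\<close>

context M_complete_category
begin

text \<open>Pullbacks \<open>p\<close> and \<open>p'\<close> of representatives \<open>n\<close> and
  \<open>n'\<close> of \<open>Q\<close> factor through each other because \<open>n\<close> and
  \<open>n'\<close> do. Conversely, precomposing a pullback with an isomorphism yields a pullback of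
  the same \<open>n\<close>.\<close>

lemma preimg_in_Sub:
  assumes f: "f \<in> Hom C X Y" and Q: "Q \<in> carrier (Sub C Y)"
  shows "preimg C f Q \<in> carrier (Sub C X)"
proof -
  obtain n where n: "n \<in> Q"
    using Sub_E[OF Q] by metis
  obtain p q where pb: "is_pullback C f n p q"
    using pullback_exists[of f n] Sub_mem[OF Q n] HomD[OF f] by metis
  have pM: "p \<in> MM C" and pX: "Cod C p = X"
    using pullback_in_M[OF Sub_mem(1)[OF Q n] pb] pb HomD[OF f] by (auto simp: is_pullback_def)
  have "preimg C f Q = sub_iso C X `` {p}"
  proof (intro equalityI subsetI)
    fix p' assume "p' \<in> preimg C f Q"
    then obtain n' q' where n': "n' \<in> Q" and pb': "is_pullback C f n' p' q'"
      by (auto simp: preimg_def)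
    have p': "p' \<in> MM C" "Cod C p' = X"
      using pullback_in_M[OF Sub_mem(1)[OF Q n'] pb'] pb' HomD[OF f] by (auto simp: is_pullback_def)
    have nn': "factors_through C n n'" "factors_through C n' n"
      using Sub_le_iff[OF Q Q] Sub_refl[OF Q] n n' by blast+
    have H: "p \<in> Hom C (Dom C p) (Dom C f)" "p' \<in> Hom C (Dom C p') (Dom C f)"
      using M_Hom[OF pM] M_Hom[OF p'(1)] pX p'(2) HomD(2)[OF f] by auto
    have "factors_through C p p'"
      using is_pullback_factors_iff[OF pb' H(1)] is_pullback_factors_iff[OF pb H(1)]
        factors_through_refl[OF M_Arr[OF pM]] factors_through_trans[OF _ nn'(1)]
        M_Arr Sub_mem(1)[OF Q n'] by blast
    moreover have "factors_through C p' p"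
      using is_pullback_factors_iff[OF pb' H(2)] is_pullback_factors_iff[OF pb H(2)]
        factors_through_refl[OF M_Arr[OF p'(1)]] factors_through_trans[OF _ nn'(2)]
        M_Arr Sub_mem(1)[OF Q n] by blast
    ultimately show "p' \<in> sub_iso C X `` {p}"
      using pM pX p' by (simp add: sub_iso_iff)
  next
    fix p' assume "p' \<in> sub_iso C X `` {p}"
    then have "(p', p) \<in> sub_iso C X"
      by (simp add: sub_iso_iff)
    then obtain j where "j \<in> Hom C (Dom C p') (Dom C p)" "is_iso C j" "p \<cdot> j = p'"
      by (auto simp: sub_iso_def)
    then show "p' \<in> preimg C f Q"
      using is_pullback_iso[OF pb] n by (auto simp: preimg_def)
  qed
  then show ?thesis
    using class_in_Sub pM pX by simp
qed

text \<open>With \<open>m\<close> representing \<open>P\<close> and \<open>n\<close> representing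
  \<open>Q\<close>, each side says that \<open>f \<cdot> m\<close> factors through \<open>n\<close>:
  the left one by orthogonality, the right one by the universal property of the pullback.\<close>

lemma img_preimg_adjoint:
  assumes f: "f \<in> Hom C X Y" and P: "P \<in> carrier (Sub C X)" and Q: "Q \<in> carrier (Sub C Y)"
  shows "img C f P \<sqsubseteq>\<^bsub>Sub C Y\<^esub> Q \<longleftrightarrow> P \<sqsubseteq>\<^bsub>Sub C X\<^esub> preimg C f Q"
proof -
  obtain m where m: "m \<in> P"
    using Sub_E[OF P] by metis
  obtain p where p: "p \<in> preimg C f Q"
    using Sub_E[OF preimg_in_Sub[OF f Q]] by metis
  then obtain n q where n: "n \<in> Q" and pb: "is_pullback C f n p q"
    by (auto simp: preimg_def)
  have "m \<in> Hom C (Dom C m) (Dom C f)"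
    using Sub_mem(3)[OF P m] HomD(2)[OF f] by simp
  then show ?thesis
    using img_le_iff[OF f P Q m n] Sub_le_iff[OF P preimg_in_Sub[OF f Q] m p]
      is_pullback_factors_iff[OF pb] by simp
qed

text \<open>A left adjoint is monotone: transpose \<open>P \<sqsubseteq> P'\<close> followed by the
  unit at \<open>P'\<close>.\<close>

lemma img_mono:
  assumes f: "f \<in> Hom C X Y" and P: "P \<in> carrier (Sub C X)" "P' \<in> carrier (Sub C X)"
    and le: "P \<sqsubseteq>\<^bsub>Sub C X\<^esub> P'"
  shows "img C f P \<sqsubseteq>\<^bsub>Sub C Y\<^esub> img C f P'"
  by (meson img_preimg_adjoint[OF f] img_in_Sub[OF f] preimg_in_Sub[OF f] P le Sub_refl Sub_trans)

lemma preimg_mono: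
  assumes f: "f \<in> Hom C X Y" and Q: "Q \<in> carrier (Sub C Y)" "Q' \<in> carrier (Sub C Y)"
    and le: "Q \<sqsubseteq>\<^bsub>Sub C Y\<^esub> Q'"
  shows "preimg C f Q \<sqsubseteq>\<^bsub>Sub C X\<^esub> preimg C f Q'"
  by (meson img_preimg_adjoint[OF f] img_in_Sub[OF f] preimg_in_Sub[OF f] Q le Sub_refl Sub_trans)

text \<open>The meet is the class of the intersection of \<open>\<Union>N\<close>, that is, of all
  representatives of all members of \<open>N\<close> at once, so none has to be chosen. An empty
  \<open>N\<close> gives the top subobject.\<close>

lemma Sub_Inf_greatest:
  assumes X: "X \<in> Obj C" and N: "N \<subseteq> carrier (Sub C X)"
  shows "greatest (Sub C X) (\<Sqinter>\<^bsub>Sub C X\<^esub> N) (Lower (Sub C X) N)"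
proof -
  have A: "\<Union>N \<subseteq> {m \<in> MM C. Cod C m = X}"
    using N Sub_mem by blast
  obtain d where d: "is_intersection C X (\<Union>N) d"
    using intersection_exists[OF X A] by blast
  have dM: "d \<in> MM C" "Cod C d = X"
    using intersection_in_M[OF X A d] d by (auto simp: is_intersection_def)
  define D where "D = sub_iso C X `` {d}"
  have D: "D \<in> carrier (Sub C X)" "d \<in> D"
    using class_in_Sub dM equiv_class_self[OF equiv_sub_iso] by (auto simp: D_def)
  have "greatest (Sub C X) D (Lower (Sub C X) N)"
    unfolding greatest_def
  proof (intro conjI ballI)
    fix P assume "P \<in> Lower (Sub C X) N"
    then have P: "P \<in> carrier (Sub C X)" and le: "\<And>Q. Q \<in> N \<Longrightarrow> P \<sqsubseteq>\<^bsub>Sub C X\<^esub> Q"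
      using N by (auto simp: Lower_def)
    obtain m where m: "m \<in> P"
      using Sub_E[OF P] by metis
    have "\<forall>n \<in> \<Union>N. factors_through C m n"
      using le N Sub_le_iff[OF P _ m] by blast
    then have "factors_through C m d"
      using d Sub_mem(3)[OF P m] unfolding is_intersection_def factors_through_def by meson
    then show "P \<sqsubseteq>\<^bsub>Sub C X\<^esub> D"
      using Sub_le_iff[OF P D(1) m D(2)] by simp
  next
    show "D \<in> Lower (Sub C X) N"
    proof -
      have "D \<sqsubseteq>\<^bsub>Sub C X\<^esub> Q" if Q: "Q \<in> N" for Q
      proof -
        have Qc: "Q \<in> carrier (Sub C X)"
          using N Q by blast
        obtain n where n: "n \<in> Q"
          using Sub_E[OF Qc] by metis
        then show ?thesis
          using Sub_le_iff[OF D(1) Qc D(2) n] d Q by (auto simp: is_intersection_def)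
      qed
      then show ?thesis
        using D(1) by (simp add: Lower_def)
    qed
  qed (rule Lower_closed)
  \<comment> \<open>The infimum is defined as some greatest lower bound, so exhibiting one, namely
    \<open>D\<close>, suffices.\<close>
  then show ?thesis
    unfolding inf_def by (rule someI)
qed

lemma Sub_Inf:
  assumes X: "X \<in> Obj C" and N: "N \<subseteq> carrier (Sub C X)"
  shows "\<Sqinter>\<^bsub>Sub C X\<^esub> N \<in> carrier (Sub C X)"
    and "P \<in> N \<Longrightarrow> \<Sqinter>\<^bsub>Sub C X\<^esub> N \<sqsubseteq>\<^bsub>Sub C X\<^esub> P"
  using Sub_Inf_greatest[OF X N] N by (auto simp: greatest_def Lower_def)

end

section \<open>The closure operator of a meet-preserving topogenous order\<close>

locale meet_preserving_topogenous_order = M_complete_category C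
  for C :: "('o, 'a) em_category" (structure) +
  fixes R :: "'o \<Rightarrow> 'a set rel"
  assumes topogenous: "topogenous_order C R"
    and meet_pres: "meet_preserving C R"
begin

lemma R_carrier:
  "X \<in> Obj C \<Longrightarrow> (m, n) \<in> R X \<Longrightarrow> m \<in> carrier (Sub C X) \<and> n \<in> carrier (Sub C X)"
  using topogenous unfolding topogenous_order_def by blast

lemma R_le: "X \<in> Obj C \<Longrightarrow> (m, n) \<in> R X \<Longrightarrow> m \<sqsubseteq>\<^bsub>Sub C X\<^esub> n"
  using topogenous unfolding topogenous_order_def by blast

lemma R_le_trans:
  assumes "X \<in> Obj C" "m \<in> carrier (Sub C X)" "q \<in> carrier (Sub C X)"
    "m \<sqsubseteq>\<^bsub>Sub C X\<^esub> n" "(n, p) \<in> R X" "p \<sqsubseteq>\<^bsub>Sub C X\<^esub> q"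
  shows "(m, q) \<in> R X"
  using topogenous assms unfolding topogenous_order_def by blast

lemma R_preimg: "f \<in> Hom C X Y \<Longrightarrow> (m, n) \<in> R Y \<Longrightarrow> (preimg C f m, preimg C f n) \<in> R X"
  using topogenous unfolding topogenous_order_def by blast

lemma R_Image_Sub: "X \<in> Obj C \<Longrightarrow> {p. (m, p) \<in> R X} \<subseteq> carrier (Sub C X)"
  using R_carrier by blast

lemma clo_of_in_Sub: "X \<in> Obj C \<Longrightarrow> clo_of C R X m \<in> carrier (Sub C X)"
  unfolding clo_of_def by (rule Sub_Inf(1)[OF _ R_Image_Sub])

lemma clo_of_lower: "X \<in> Obj C \<Longrightarrow> (m, p) \<in> R X \<Longrightarrow> clo_of C R X m \<sqsubseteq>\<^bsub>Sub C X\<^esub> p"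
  unfolding clo_of_def by (rule Sub_Inf(2)[OF _ R_Image_Sub]) simp_all

text \<open>Meet preservation, applied to the set of all \<open>p\<close> with
  \<open>(m, p) \<in> R X\<close>, puts the meet of this set into it. So the closure of
  \<open>m\<close> is the least subobject to which \<open>m\<close> is related.\<close>

lemma R_clo_of:
  assumes "X \<in> Obj C" "m \<in> carrier (Sub C X)"
  shows "(m, clo_of C R X m) \<in> R X"
  using meet_pres assms R_Image_Sub[OF assms(1), of m]
  by (simp add: meet_preserving_def clo_of_def)

lemma closure_operator_clo_of: "closure_operator C (clo_of C R)"
  unfolding closure_operator_def
proof (intro conjI ballI allI impI funcsetI)
  fix X m assume X: "X \<in> Obj C" and m: "m \<in> carrier (Sub C X)"
  show "clo_of C R X m \<in> carrier (Sub C X)"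
    using clo_of_in_Sub X .
  show "m \<sqsubseteq>\<^bsub>Sub C X\<^esub> clo_of C R X m"
    using R_le X R_clo_of m by blast
  fix n assume n: "n \<in> carrier (Sub C X)" and le: "m \<sqsubseteq>\<^bsub>Sub C X\<^esub> n"
  \<comment> \<open>By (T2), \<open>m \<sqsubseteq> n\<close> extends the relation of
    \<open>n\<close> to its closure down to \<open>m\<close>; the closure of \<open>n\<close> is
    then one of the subobjects whose meet is the closure of \<open>m\<close>.\<close>
  have "(m, clo_of C R X n) \<in> R X"
    using R_le_trans[OF X m _ le R_clo_of[OF X n]] clo_of_in_Sub[OF X] Sub_refl by blast
  then show "clo_of C R X m \<sqsubseteq>\<^bsub>Sub C X\<^esub> clo_of C R X n"
    using clo_of_lower X by blast
next
  fix X Y f m assume f: "f \<in> Hom C X Y" and m: "m \<in> carrier (Sub C X)"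
  note X = Hom_Obj(1)[OF f] and Y = Hom_Obj(2)[OF f] and fm = img_in_Sub[OF f m]
  note q = preimg_in_Sub[OF f clo_of_in_Sub[OF Y, of "img C f m"]]
  \<comment> \<open>The unit of the adjunction, combined with (T3) for the relation of the image of
    \<open>m\<close> to its closure, relates \<open>m\<close> to the preimage of that closure. This
    preimage is therefore above the closure of \<open>m\<close>, and transposing gives (C3).\<close>
  have "m \<sqsubseteq>\<^bsub>Sub C X\<^esub> preimg C f (img C f m)"
    using img_preimg_adjoint[OF f m fm] Sub_refl[OF fm] by blast
  then have "(m, preimg C f (clo_of C R Y (img C f m))) \<in> R X"
    using R_le_trans[OF X m q _ R_preimg[OF f R_clo_of[OF Y fm]]] Sub_refl[OF q] by blast
  then show "img C f (clo_of C R X m) \<sqsubseteq>\<^bsub>Sub C Y\<^esub> clo_of C R Y (img C f m)"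
    using img_preimg_adjoint[OF f clo_of_in_Sub[OF X] clo_of_in_Sub[OF Y]] clo_of_lower[OF X]
    by simp
qed

text \<open>Interpolate between \<open>m\<close> and its closure by \<open>p\<close>. The closure of
  \<open>m\<close> is below \<open>p\<close>, and \<open>p\<close> is related to that closure, so by
  (T2) the closure is related to itself; it is then above its own closure.\<close>

lemma clo_of_idem:
  assumes "interpolative C R" and X: "X \<in> Obj C" and m: "m \<in> carrier (Sub C X)"
  shows "clo_of C R X (clo_of C R X m) \<sqsubseteq>\<^bsub>Sub C X\<^esub> clo_of C R X m"
proof -
  note cm = clo_of_in_Sub[OF X, of m]
  obtain p where p: "(m, p) \<in> R X" "(p, clo_of C R X m) \<in> R X"
    using assms(1) X R_clo_of[OF X m] unfolding interpolative_def by blast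
  have "(clo_of C R X m, clo_of C R X m) \<in> R X"
    using R_le_trans[OF X cm cm clo_of_lower[OF X p(1)] p(2)] Sub_refl[OF cm] by blast
  then show ?thesis
    by (rule clo_of_lower[OF X])
qed

end

section \<open>Closure operators and their pullback along a pointed endofunctor\<close>

context M_complete_category
begin

context
  fixes c
  assumes c: "closure_operator C c"
begin

lemma closure_closed: "X \<in> Obj C \<Longrightarrow> m \<in> carrier (Sub C X) \<Longrightarrow> c X m \<in> carrier (Sub C X)"
  using c by (auto simp: closure_operator_def)

lemma closure_ext: "X \<in> Obj C \<Longrightarrow> m \<in> carrier (Sub C X) \<Longrightarrow> m \<sqsubseteq>\<^bsub>Sub C X\<^esub> c X m"
  using c by (auto simp: closure_operator_def)

lemma closure_mono:
  "X \<in> Obj C \<Longrightarrow> m \<in> carrier (Sub C X) \<Longrightarrow> n \<in> carrier (Sub C X) \<Longrightarrow>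
    m \<sqsubseteq>\<^bsub>Sub C X\<^esub> n \<Longrightarrow> c X m \<sqsubseteq>\<^bsub>Sub C X\<^esub> c X n"
  using c by (auto simp: closure_operator_def)

lemma closure_img:
  "f \<in> Hom C X Y \<Longrightarrow> m \<in> carrier (Sub C X) \<Longrightarrow>
    img C f (c X m) \<sqsubseteq>\<^bsub>Sub C Y\<^esub> c Y (img C f m)"
  using c by (auto simp: closure_operator_def)

end

end

text \<open>The construction is carried out for an arbitrary closure operator \<open>k\<close>,
  later taken to be \<open>clo_of C R\<close>. Since functions are total, \<open>c_eq\<close>
  prescribes \<open>c\<close> on objects and their subobjects only.\<close>

locale pointed_closure = M_complete_category C + pointed_endofunctor C Fo Fa \<eta>
  for C :: "('o, 'a) em_category" (structure)
    and Fo :: "'o \<Rightarrow> 'o" and Fa :: "'a \<Rightarrow> 'a" and \<eta> :: "'o \<Rightarrow> 'a" +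
  fixes k c :: "'o \<Rightarrow> 'a set \<Rightarrow> 'a set"
  assumes k: "closure_operator C k"
    and c_eq: "X \<in> Obj C \<Longrightarrow> m \<in> carrier (Sub C X) \<Longrightarrow>
      c X m = preimg C (\<eta> X) (k (Fo X) (img C (\<eta> X) m))"
begin

lemma img_eta_in_Sub:
  "X \<in> Obj C \<Longrightarrow> m \<in> carrier (Sub C X) \<Longrightarrow> img C (\<eta> X) m \<in> carrier (Sub C (Fo X))"
  by (rule img_in_Sub[OF eta_in_Hom])

lemma k_img_eta_in_Sub:
  "X \<in> Obj C \<Longrightarrow> m \<in> carrier (Sub C X) \<Longrightarrow>
    k (Fo X) (img C (\<eta> X) m) \<in> carrier (Sub C (Fo X))"
  by (rule closure_closed[OF k Fo_in_Obj img_eta_in_Sub])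

lemma c_in_Sub: "X \<in> Obj C \<Longrightarrow> m \<in> carrier (Sub C X) \<Longrightarrow> c X m \<in> carrier (Sub C X)"
  using c_eq preimg_in_Sub[OF eta_in_Hom k_img_eta_in_Sub] by simp

text \<open>Transposing \<open>c_eq\<close> along the adjunction exhibits \<open>c X m\<close> as
  the largest \<open>n\<close> whose image under \<open>\<eta> X\<close> is below the
  \<open>k\<close>-closure of the image of \<open>m\<close>. Extensivity, (C3), idempotency and
  maximality are all read off from this.\<close>

lemma le_c_iff:
  assumes "X \<in> Obj C" "m \<in> carrier (Sub C X)" "n \<in> carrier (Sub C X)"
  shows "n \<sqsubseteq>\<^bsub>Sub C X\<^esub> c X m \<longleftrightarrow>
    img C (\<eta> X) n \<sqsubseteq>\<^bsub>Sub C (Fo X)\<^esub> k (Fo X) (img C (\<eta> X) m)"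
  using img_preimg_adjoint[OF eta_in_Hom] k_img_eta_in_Sub c_eq assms by simp

lemma img_c_le:
  "X \<in> Obj C \<Longrightarrow> m \<in> carrier (Sub C X) \<Longrightarrow>
    img C (\<eta> X) (c X m) \<sqsubseteq>\<^bsub>Sub C (Fo X)\<^esub> k (Fo X) (img C (\<eta> X) m)"
  using le_c_iff[OF _ _ c_in_Sub] Sub_refl[OF c_in_Sub] by simp

lemma closure_operator_c: "closure_operator C c"
  unfolding closure_operator_def
proof (intro conjI ballI allI impI funcsetI)
  fix X m assume X: "X \<in> Obj C" and m: "m \<in> carrier (Sub C X)"
  show "c X m \<in> carrier (Sub C X)"
    using c_in_Sub X m .
  show "m \<sqsubseteq>\<^bsub>Sub C X\<^esub> c X m"
    using le_c_iff[OF X m m] closure_ext[OF k] img_eta_in_Sub[OF X m] Fo_in_Obj[OF X] by blast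
  fix n assume n: "n \<in> carrier (Sub C X)" and le: "m \<sqsubseteq>\<^bsub>Sub C X\<^esub> n"
  have "k (Fo X) (img C (\<eta> X) m) \<sqsubseteq>\<^bsub>Sub C (Fo X)\<^esub> k (Fo X) (img C (\<eta> X) n)"
    using closure_mono[OF k Fo_in_Obj[OF X]] img_mono[OF eta_in_Hom[OF X] m n le]
      img_eta_in_Sub[OF X] m n by simp
  then show "c X m \<sqsubseteq>\<^bsub>Sub C X\<^esub> c X n"
    using preimg_mono[OF eta_in_Hom[OF X]] k_img_eta_in_Sub c_eq X m n by simp
next
  fix X Y f m assume f: "f \<in> Hom C X Y" and m: "m \<in> carrier (Sub C X)"
  note X = Hom_Obj(1)[OF f] and Y = Hom_Obj(2)[OF f]
  note hX = eta_in_Hom[OF X] and hY = eta_in_Hom[OF Y] and Ff = Fa_in_Hom[OF f]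
  note em = img_eta_in_Sub[OF X m] and kem = k_img_eta_in_Sub[OF X m] and cm = c_in_Sub[OF X m]
  \<comment> \<open>Naturality of \<eta> at \<open>f\<close>, carried over to subobjects by
    functoriality of images. It replaces \<open>f\<close> by \<open>Fa f\<close>, to which (C3) for
    \<open>k\<close> applies.\<close>
  have nat: "img C (\<eta> Y) (img C f n) = img C (Fa f) (img C (\<eta> X) n)"
    if "n \<in> carrier (Sub C X)" for n
    using img_comp[OF f hY that] img_comp[OF hX Ff that] eta_natural[OF f] by simp
  have "img C (Fa f) (img C (\<eta> X) (c X m)) \<sqsubseteq>\<^bsub>Sub C (Fo Y)\<^esub> img C (Fa f) (k (Fo X) (img C (\<eta> X) m))"
    using img_mono[OF Ff img_eta_in_Sub[OF X cm] kem img_c_le[OF X m]] .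
  moreover have "img C (Fa f) (k (Fo X) (img C (\<eta> X) m)) \<sqsubseteq>\<^bsub>Sub C (Fo Y)\<^esub> k (Fo Y) (img C (Fa f) (img C (\<eta> X) m))"
    using closure_img[OF k Ff em] .
  ultimately have "img C (Fa f) (img C (\<eta> X) (c X m)) \<sqsubseteq>\<^bsub>Sub C (Fo Y)\<^esub>
      k (Fo Y) (img C (Fa f) (img C (\<eta> X) m))"
    by (rule Sub_trans[OF img_in_Sub[OF Ff img_eta_in_Sub[OF X cm]] img_in_Sub[OF Ff kem]
          closure_closed[OF k Fo_in_Obj[OF Y] img_in_Sub[OF Ff em]]])
  \<comment> \<open>By \<open>le_c_iff\<close> at \<open>Y\<close>, the goal compares images under
    \<open>\<eta> Y\<close>; \<open>nat\<close> at \<open>c X m\<close> and at \<open>m\<close>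
    turns it into the inequality just derived.\<close>
  then show "img C f (c X m) \<sqsubseteq>\<^bsub>Sub C Y\<^esub> c Y (img C f m)"
    using le_c_iff[OF Y] img_in_Sub[OF f] m cm nat by simp
qed

text \<open>Writing \<open>e\<close> for the image under \<open>\<eta> X\<close>, the chain is
  \<open>e (c (c m)) \<sqsubseteq> k (e (c m)) \<sqsubseteq> k (k (e m)) \<sqsubseteq> k (e
  m)\<close>; by \<open>le_c_iff\<close> this says \<open>c (c m) \<sqsubseteq> c m\<close>.
  Extensivity of \<open>c\<close> gives the converse.\<close>

lemma idempotent_closure_c:
  assumes idem: "\<And>X m. X \<in> Obj C \<Longrightarrow> m \<in> carrier (Sub C X) \<Longrightarrow>
    k X (k X m) \<sqsubseteq>\<^bsub>Sub C X\<^esub> k X m"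
  shows "idempotent_closure C c"
  unfolding idempotent_closure_def idempotent_def
proof (intro ballI)
  fix X m assume X: "X \<in> Obj C" and m: "m \<in> carrier (Sub C X)"
  note FX = Fo_in_Obj[OF X] and em = img_eta_in_Sub[OF X m] and kem = k_img_eta_in_Sub[OF X m]
    and cm = c_in_Sub[OF X m]
  note ecm = img_eta_in_Sub[OF X cm] and ccm = c_in_Sub[OF X cm]
  note eccm = img_eta_in_Sub[OF X ccm]
  have "k (Fo X) (img C (\<eta> X) (c X m)) \<sqsubseteq>\<^bsub>Sub C (Fo X)\<^esub> k (Fo X) (k (Fo X) (img C (\<eta> X) m))"
    using closure_mono[OF k FX ecm kem img_c_le[OF X m]] .
  then have "k (Fo X) (img C (\<eta> X) (c X m)) \<sqsubseteq>\<^bsub>Sub C (Fo X)\<^esub> k (Fo X) (img C (\<eta> X) m)"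
    by (rule Sub_trans[OF closure_closed[OF k FX ecm] closure_closed[OF k FX kem] kem])
      (rule idem[OF FX em])
  then have "img C (\<eta> X) (c X (c X m)) \<sqsubseteq>\<^bsub>Sub C (Fo X)\<^esub> k (Fo X) (img C (\<eta> X) m)"
    by (rule Sub_trans[OF eccm k_img_eta_in_Sub[OF X cm] kem img_c_le[OF X cm]])
  then have "c X (c X m) \<sqsubseteq>\<^bsub>Sub C X\<^esub> c X m"
    using le_c_iff[OF X m ccm] by blast
  then have "c X (c X m) = c X m"
    using Sub_antisym[OF ccm cm] closure_ext[OF closure_operator_c X cm] by blast
  then show "c X (c X m) .=\<^bsub>Sub C X\<^esub> c X m"
    by (simp add: Sub_def)
qed

text \<open>Pointwise this is \<open>le_c_iff\<close> with \<open>n\<close> taken to be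
  \<open>c' X m\<close>. It yields maximality of \<open>c\<close> directly and, for
  \<open>c'\<close> equal to \<open>c\<close>, the continuity of every
  \<open>\<eta> X\<close>.\<close>

lemma closure_continuous_iff:
  assumes c': "closure_operator C c'"
  shows "(\<forall>X \<in> Obj C. closure_continuous C c' k (\<eta> X)) \<longleftrightarrow> closure_le C c' c"
  unfolding closure_continuous_def closure_le_def
  using le_c_iff closure_closed[OF c'] HomD[OF eta_in_Hom] by simp

end

theorem proposition6:
  fixes C :: "('o, 'a) em_category"
    and Fo :: "'o \<Rightarrow> 'o" and Fa :: "'a \<Rightarrow> 'a" and \<eta> :: "'o \<Rightarrow> 'a"
    and S :: "'o \<Rightarrow> 'a set rel set" and R :: "'o \<Rightarrow> 'a set rel"
    and c :: "'o \<Rightarrow> 'a set \<Rightarrow> 'a set"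
  assumes "E_stable_M_complete_category C"
    and "pointed_endofunctor C Fo Fa \<eta>"
    and "simple_coperfect_syntopogenous C S R"
    and "\<And>X m. X \<in> Obj C \<Longrightarrow> m \<in> carrier (Sub C X) \<Longrightarrow>
           c X m = preimg C (\<eta> X) (clo_of C R (Fo X) (img C (\<eta> X) m))"
  shows "closure_operator C c \<and> idempotent_closure C c \<and>
         (\<forall>X \<in> Obj C. closure_continuous C c (clo_of C R) (\<eta> X)) \<and>
         (\<forall>c'. closure_operator C c' \<and>
               (\<forall>X \<in> Obj C. closure_continuous C c' (clo_of C R) (\<eta> X)) \<longrightarrow>
               closure_le C c' c)"
proof -
  interpret E_stable_M_complete_category C by fact
  interpret pointed_endofunctor C Fo Fa \<eta> by fact
  interpret meet_preserving_topogenous_order C R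
    using assms(3) by unfold_locales (auto simp: simple_coperfect_syntopogenous_def)
  interpret pointed_closure C Fo Fa \<eta> "clo_of C R" c
    using closure_operator_clo_of assms(4) by unfold_locales
  \<comment> \<open>Interpolation enters here: \<open>clo_of_idem\<close> provides the inequality
    that \<open>idempotent_closure_c\<close> asks of \<open>k\<close>.\<close>
  have "idempotent_closure C c"
    using idempotent_closure_c clo_of_idem assms(3)
    by (simp add: simple_coperfect_syntopogenous_def)
  \<comment> \<open>Through \<open>closure_continuous_iff\<close>, this reflexivity becomes the
    continuity of each \<open>\<eta> X\<close> with respect to \<open>c\<close> and
    \<open>clo_of C R\<close>.\<close>
  moreover have "closure_le C c c"
    using Sub_refl c_in_Sub by (simp add: closure_le_def)
  ultimately show ?thesis
    using closure_operator_c closure_continuous_iff by blast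
qed

end
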